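(* Let $\Gamma$ be an irreducible subgroup of $\mathrm{SU}(2,1)$ such that $\mathbb{Q}(\Gamma)$ is a subset of $\mathbb{R}$. Then $\Gamma$ is conjugate in $\mathrm{SU}(2,1)$ to a subgroup of $\mathrm{SO}(2,1)$.
   Context: Let $V=\mathbb{C}^{3}$ with the Hermitian form $\langle z,w\rangle=z_1\bar w_3+z_2\bar w_2+z_3\bar w_1$ of signature $(2,1)$. $\mathrm{SU}(2,1)$ is the group of $3\times 3$ complex matrices of determinant $1$ preserving this form, and $\mathrm{SO}(2,1)$ is identified with the stabilizer in $\mathrm{SU}(2,1)$ of the real subspace $\mathbb{R}^3\subset V$, i.e. $\mathrm{SO}(2,1)=\mathrm{SU}(2,1)\cap \mathrm{M}(3,\mathbb{R})$. A subgroup $\Gamma$ of $\mathrm{SU}(2,1)$ is reducible if it has an invariant proper nonzero $\mathbb{C}$-subspace of $V$, and irreducible otherwise; $\Gamma$ is not assumed to be discrete. The trace field $\mathbb{Q}(\Gamma)$ is the subfield of $\mathbb{C}$ generated over $\mathbb{Q}$ by the traces of all elements of $\Gamma$. *)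

theory Defs
  imports
    "HOL-Analysis.Analysis"
    "HOL-Algebra.Coset"
    "HOL-Algebra.Generated_Fields"
    "HOL-Algebra.Algebraic_Closure_Type"
begin

definition herm :: "complex ^ 3 \<Rightarrow> complex ^ 3 \<Rightarrow> complex" where
  "herm z w = z $ 1 * cnj (w $ 3) + z $ 2 * cnj (w $ 2) + z $ 3 * cnj (w $ 1)"

definition SU21 :: "(complex ^ 3 ^ 3) monoid" where
  "SU21 = \<lparr> carrier = {A. det A = 1 \<and> (\<forall>z w. herm (A *v z) (A *v w) = herm z w)},
            monoid.mult = (**), one = mat 1 \<rparr>"

definition SO21 :: "(complex ^ 3 ^ 3) monoid" where
  "SO21 = SU21 \<lparr> carrier := carrier SU21 \<inter> {A. \<forall>i j. A $ i $ j \<in> \<real>} \<rparr>"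

text \<open>
  Complex subspaces are those of the vector space structure given by \<^const>\<open>vector_scalar_mult\<close>;
  the unqualified \<open>subspace\<close> would mean real subspaces.
\<close>

definition reducible :: "(complex ^ 3 ^ 3) set \<Rightarrow> bool" where
  "reducible \<Gamma> \<longleftrightarrow> (\<exists>W. vec.subspace W \<and> W \<noteq> {0} \<and> W \<noteq> UNIV \<and> (\<forall>A\<in>\<Gamma>. (*v) A ` W \<subseteq> W))"

text \<open>
  A subfield of the complex numbers always contains the rationals, so it suffices to generate
  from the traces.
\<close>

definition trace_field :: "(complex ^ 3 ^ 3) set \<Rightarrow> complex set" where
  "trace_field \<Gamma> = generate_field ring_of_type_algebra (trace ` \<Gamma>)"

lemma SU21_simps:
  "A \<in> carrier SU21 \<longleftrightarrow> det A = 1 \<and> (\<forall>z w. herm (A *v z) (A *v w) = herm z w)"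
  "A \<otimes>\<^bsub>SU21\<^esub> B = A ** B"
  "\<one>\<^bsub>SU21\<^esub> = mat 1"
  by (simp_all add: SU21_def)

lemma SU21_matrix_inv:
  assumes "A \<in> carrier SU21"
  shows "matrix_inv A \<in> carrier SU21" "matrix_inv A ** A = mat 1" "A ** matrix_inv A = mat 1"
proof -
  have det: "det A = 1" and pres: "herm (A *v z) (A *v w) = herm z w" for z w
    using assms by (auto simp: SU21_simps)
  have inv: "invertible A"
    using det by (simp add: invertible_det_nz)
  have "A ** matrix_inv A = mat 1 \<and> matrix_inv A ** A = mat 1"
    using inv unfolding invertible_def matrix_inv_def by (rule someI_ex)
  then show l: "matrix_inv A ** A = mat 1" and r: "A ** matrix_inv A = mat 1"
    by simp_all
  have "det (matrix_inv A) = 1"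
    using arg_cong[OF r, of det] det by (simp add: det_mul)
  moreover have "herm (matrix_inv A *v z) (matrix_inv A *v w) = herm z w" for z w
    using pres[of "matrix_inv A *v z" "matrix_inv A *v w"] r
    by (simp add: matrix_vector_mul_assoc)
  ultimately show "matrix_inv A \<in> carrier SU21"
    by (simp add: SU21_simps)
qed

lemma group_SU21: "group SU21"
proof (rule groupI)
  fix A assume "A \<in> carrier SU21"
  then show "\<exists>B\<in>carrier SU21. B \<otimes>\<^bsub>SU21\<^esub> A = \<one>\<^bsub>SU21\<^esub>"
    using SU21_matrix_inv by (auto simp: SU21_simps(2,3))
qed (auto simp: SU21_simps det_mul matrix_mul_assoc simp flip: matrix_vector_mul_assoc)

lemma inv_SU21: "A \<in> carrier SU21 \<Longrightarrow> inv\<^bsub>SU21\<^esub> A = matrix_inv A"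
  using group.inv_equality[OF group_SU21] SU21_matrix_inv by (metis SU21_simps(2,3))

lemma subgroup_SO21: "subgroup (carrier SO21) SU21"
proof
  interpret group SU21 by (rule group_SU21)
  have carrier: "carrier SO21 = carrier SU21 \<inter> {A. \<forall>i j. A $ i $ j \<in> \<real>}"
    by (simp add: SO21_def)
  show "carrier SO21 \<subseteq> carrier SU21"
    by (simp add: carrier)
  show "\<one>\<^bsub>SU21\<^esub> \<in> carrier SO21"
    using one_closed by (auto simp: carrier SU21_simps(3) mat_def)
  show "A \<otimes>\<^bsub>SU21\<^esub> B \<in> carrier SO21" if "A \<in> carrier SO21" "B \<in> carrier SO21" for A B
    using that m_closed[of A B]
    by (auto simp: carrier SU21_simps(2) matrix_matrix_mult_def intro!: sum_in_Reals Reals_mult)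
  show "inv\<^bsub>SU21\<^esub> A \<in> carrier SO21" if A: "A \<in> carrier SO21" for A
  proof -
    let ?B = "matrix_inv A"
    define C :: "complex ^ 3 ^ 3" where "C = (\<chi> i j. cnj (?B $ i $ j))"
    have AU: "A \<in> carrier SU21" and real: "cnj (A $ i $ j) = A $ i $ j" for i j
      using A by (auto simp: carrier Reals_cnj_iff)
    have "(C ** A) $ i $ j = cnj ((?B ** A) $ i $ j)" for i j
      by (simp add: C_def matrix_matrix_mult_def real)
    then have "C ** A = mat 1"
      using SU21_matrix_inv(2)[OF AU] by (simp add: vec_eq_iff mat_def)
    then have "C = ?B"
      using SU21_matrix_inv(3)[OF AU] by (metis matrix_mul_assoc matrix_mul_lid matrix_mul_rid)
    then have "cnj (?B $ i $ j) = ?B $ i $ j" for i j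
      by (metis C_def vec_lambda_beta)
    then show ?thesis
      using AU SU21_matrix_inv(1)[OF AU] by (simp add: carrier inv_SU21 Reals_cnj_iff)
  qed
qed

lemma SO21_stabilizer:
  "A \<in> carrier SO21 \<longleftrightarrow>
     A \<in> carrier SU21 \<and> (*v) A ` {z. \<forall>i. z $ i \<in> \<real>} = {z. \<forall>i. z $ i \<in> \<real>}"
  (is "_ \<longleftrightarrow> _ \<and> _ ` ?R = ?R")
proof -
  have entries: "(\<forall>i j. B $ i $ j \<in> \<real>) \<longleftrightarrow> (*v) B ` ?R \<subseteq> ?R" for B :: "complex ^ 3 ^ 3"
  proof
    assume "\<forall>i j. B $ i $ j \<in> \<real>"
    then show "(*v) B ` ?R \<subseteq> ?R"
      by (auto simp: matrix_vector_mult_def intro!: sum_in_Reals Reals_mult)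
  next
    assume B: "(*v) B ` ?R \<subseteq> ?R"
    show "\<forall>i j. B $ i $ j \<in> \<real>"
    proof (intro allI)
      fix i j
      have "axis j 1 \<in> ?R"
        by (auto simp: axis_def)
      then have "(B *v axis j 1) $ i \<in> \<real>"
        using B by blast
      then show "B $ i $ j \<in> \<real>"
        by (simp add: matrix_vector_mult_def axis_def if_distrib cong: if_cong)
    qed
  qed
  have carrier: "B \<in> carrier SO21 \<longleftrightarrow> B \<in> carrier SU21 \<and> (*v) B ` ?R \<subseteq> ?R" for B
    by (simp only: SO21_def) (simp add: entries)
  have "?R \<subseteq> (*v) A ` ?R" if A: "A \<in> carrier SO21"
  proof
    fix z assume z: "z \<in> ?R"
    have AU: "A \<in> carrier SU21"
      using A carrier by blast
    then have "matrix_inv A \<in> carrier SO21"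
      using subgroup.m_inv_closed[OF subgroup_SO21 A] by (simp add: inv_SU21)
    then have "matrix_inv A *v z \<in> ?R"
      using z carrier by blast
    moreover have "z = A *v (matrix_inv A *v z)"
      using SU21_matrix_inv(3)[OF AU] by (simp add: matrix_vector_mul_assoc)
    ultimately show "z \<in> (*v) A ` ?R"
      by (rule rev_image_eqI)
  qed
  then show ?thesis
    using carrier[of A] by blast
qed

end

theory Submission
  imports Defs
begin

text \<open>
  Since the traces are real, the irreducible group \<open>\<Gamma>\<close> and its complex conjugate have the same
  character, so Burnside's theorem yields \<open>S\<close> with \<open>S A = cnj A S\<close> for all \<open>A\<close> in \<open>\<Gamma>\<close>. By Schur's lemma
  \<open>cnj S S\<close> is a scalar, and it is positive because the dimension is odd; after rescaling, \<open>S\<close> defines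
  a \<open>\<Gamma>\<close>-invariant real structure. With \<open>J\<close> the matrix of the Hermitian form, \<open>J S\<close> is an invariant
  bilinear form, hence symmetric, again because the dimension is odd. So the Hermitian form is real on
  the real vectors, which therefore contain a basis with Gram matrix \<open>J\<close>. The change to this
  basis conjugates \<open>\<Gamma>\<close> into real matrices, and a unit scalar corrects its determinant.
\<close>

section \<open>Scalar matrices and standard basis vectors\<close>

lemma mat_mult_component: "(mat c ** A) $ i $ j = c * (A :: 'a::semiring_1 ^ 'm ^ 'n) $ i $ j"
proof -
  have "(mat c ** A) $ i $ j = (\<Sum>k\<in>UNIV. if k = i then c * A $ k $ j else 0)"
    unfolding matrix_matrix_mult_def mat_def by (simp only: vec_lambda_beta, intro sum.cong) auto
  then show ?thesis by simp
qed

lemma mat_mult_commute: "A ** mat c = mat c ** (A :: 'a::comm_semiring_1 ^ 'n ^ 'n)"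
proof -
  have "(A ** mat c) $ i $ j = (\<Sum>k\<in>UNIV. if k = j then A $ i $ k * c else 0)" for i j
    unfolding matrix_matrix_mult_def mat_def by (simp only: vec_lambda_beta, intro sum.cong) auto
  then show ?thesis by (simp add: vec_eq_iff mat_mult_component mult.commute)
qed

lemma mat_mult_vector: "mat c *v x = c *s (x :: 'a::semiring_1 ^ 'n)"
proof -
  have "(mat c *v x) $ i = (\<Sum>k\<in>UNIV. if k = i then c * x $ k else 0)" for i
    unfolding matrix_vector_mult_def mat_def by (simp only: vec_lambda_beta, intro sum.cong) auto
  then show ?thesis by (simp add: vec_eq_iff)
qed

lemma mat_mult_mat: "mat c ** mat d = (mat (c * d) :: 'a::semiring_1 ^ 'n ^ 'n)"
  by (simp add: vec_eq_iff mat_mult_component) (simp add: mat_def)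

lemma matrix_vector_mult_smult: "A *v (c *s x) = c *s (A *v (x :: 'a::field ^ 'n))"
  by (simp add: vector_scalar_commute)

lemma matrix_mult_axis: "A *v axis j 1 = column j (A :: 'a::semiring_1 ^ 'n ^ 'm)"
proof -
  have "(A *v axis j 1) $ i = (\<Sum>k\<in>UNIV. if k = j then A $ i $ k else 0)" for i
    unfolding matrix_vector_mult_def axis_def by (simp only: vec_lambda_beta, intro sum.cong) auto
  then show ?thesis by (simp add: vec_eq_iff column_def)
qed

section \<open>Burnside's theorem\<close>

text \<open>Induction on the degree. A root \<open>a\<close> splits off as
  \<open>p = [:-a, 1:] * q\<close>. Either \<open>q(B) w\<close> is an eigenvector for
  \<open>a\<close>, or it vanishes and \<open>q\<close> annihilates \<open>w\<close> in lower
  degree. A nonzero constant cannot annihilate \<open>w\<close>.\<close>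

lemma eigenvector_of_annihilating_poly:
  fixes B :: "complex ^ 'n ^ 'n" and p :: "complex poly"
  assumes W: "vec.subspace W" "\<And>x. x \<in> W \<Longrightarrow> B *v x \<in> W"
    and w: "w \<in> W" "w \<noteq> 0"
    and p: "p \<noteq> 0" "(\<Sum>i\<le>Polynomial.degree p. Polynomial.coeff p i *s ((*v) B ^^ i) w) = 0"
  shows "\<exists>l v. v \<in> W \<and> v \<noteq> 0 \<and> B *v v = l *s v"
  using p
proof (induction "Polynomial.degree p" arbitrary: p)
  case 0
  then obtain c where "p = [:c:]" using Polynomial.degree_eq_zeroE[of p] by metis
  with 0 w(2) show ?case by simp
next
  case (Suc n)
  let ?v = "\<lambda>i. ((*v) B ^^ i) w"
  have inW: "?v i \<in> W" for i by (induction i) (use W w in auto)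
  have "\<not> constant (poly p)"
    using Suc.hyps(2) by (simp add: constant_degree)
  then obtain a where "poly p a = 0" using fundamental_theorem_of_algebra by blast
  then obtain q where pq: "p = [:-a, 1:] * q" using poly_eq_0_iff_dvd by blast
  with Suc.prems have q0: "q \<noteq> 0" by auto
  then have dq: "Polynomial.degree q = n" using Suc.hyps(2) unfolding pq by (subst (asm) degree_mult_eq) auto
  define u where "u = (\<Sum>i\<le>n. Polynomial.coeff q i *s ?v i)"
  have uW: "u \<in> W" unfolding u_def
    by (intro vec.subspace_sum vec.subspace_scale W inW)
  have Bu: "B *v u = (\<Sum>i\<le>n. Polynomial.coeff q i *s ?v (Suc i))"
    unfolding u_def by (simp add: vec.linear_sum[OF matrix_vector_mul_linear_gen] matrix_vector_mult_smult)
  \<comment> \<open>The shifted sequence in the case distinction holds the coefficients of X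
    q.\<close>
  have cp: "Polynomial.coeff p i = (case i of 0 \<Rightarrow> 0 | Suc j \<Rightarrow> Polynomial.coeff q j) - a * Polynomial.coeff q i" for i
    unfolding pq by (simp add: coeff_pCons split: nat.split)
  have "0 = (\<Sum>i\<le>Suc n. Polynomial.coeff p i *s ?v i)"
    using Suc.prems(2) Suc.hyps(2) by simp
  also have "\<dots> = (\<Sum>i\<le>Suc n. (case i of 0 \<Rightarrow> 0 | Suc j \<Rightarrow> Polynomial.coeff q j) *s ?v i) - a *s (\<Sum>i\<le>Suc n. Polynomial.coeff q i *s ?v i)"
    unfolding cp by (simp add: vector_sub_rdistrib sum_subtractf vec.scale_sum_right vector_smult_assoc del: sum.atMost_Suc)
  also have "(\<Sum>i\<le>Suc n. (case i of 0 \<Rightarrow> 0 | Suc j \<Rightarrow> Polynomial.coeff q j) *s ?v i) = B *v u"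
    unfolding Bu by (subst sum.atMost_Suc_shift) simp
  also have "(\<Sum>i\<le>Suc n. Polynomial.coeff q i *s ?v i) = u"
    unfolding u_def using dq by (simp add: coeff_eq_0)
  finally have "B *v u = a *s u" by simp
  show ?case
  proof (cases "u = 0")
    case True
    then show ?thesis using Suc.hyps(1)[of q] dq q0 by (simp add: u_def)
  next
    case False
    with uW \<open>B *v u = a *s u\<close> show ?thesis by blast
  qed
qed

text \<open>The vectors \<open>w\<close>, \<open>B w\<close>, ..., up to exponent
  \<open>CARD('n)\<close> are one too many to be independent, so some nonzero polynomial in
  \<open>B\<close> kills \<open>w\<close>. Starting from \<open>w\<close> in \<open>W\<close> keeps
  the eigenvector in \<open>W\<close>.\<close>

lemma eigenvector_in_invariant_subspace:
  fixes B :: "complex ^ 'n ^ 'n"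
  assumes W: "vec.subspace W" "\<And>x. x \<in> W \<Longrightarrow> B *v x \<in> W" and ne: "W \<noteq> {0}"
  obtains l v where "v \<in> W" "v \<noteq> 0" "B *v v = l *s v"
proof -
  obtain w where w: "w \<in> W" "w \<noteq> 0" using ne vec.subspace_0[OF W(1)] by auto
  let ?v = "\<lambda>i. ((*v) B ^^ i) w" and ?N = "CARD('n)"
  have "\<exists>p::complex poly. p \<noteq> 0 \<and> (\<Sum>i\<le>Polynomial.degree p. Polynomial.coeff p i *s ?v i) = 0"
  proof -
    have "\<exists>c. (\<exists>i\<le>?N. c i \<noteq> 0) \<and> (\<Sum>i\<le>?N. c i *s ?v i) = 0"
    \<comment> \<open>Dependence is a property of sets, so a repetition among the iterates is
      treated apart: it gives a relation with coefficients 1 and -1.\<close>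
    proof (cases "inj_on ?v {..?N}")
      case True
      have "vec.dependent (?v ` {..?N})"
        using True by (intro vec.dependent_biggerset_general) 
          (auto simp: card_image dim_subset_UNIV_cart_gen less_Suc_eq_le)
      then obtain u where u: "\<exists>x\<in>?v ` {..?N}. u x \<noteq> 0" "(\<Sum>x\<in>?v ` {..?N}. u x *s x) = 0"
        by (subst (asm) vec.dependent_finite) auto
      have "(\<Sum>i\<le>?N. u (?v i) *s ?v i) = 0"
        using u(2) by (subst (asm) sum.reindex[OF True]) simp
      then show ?thesis using u(1) by (intro exI[of _ "\<lambda>i. u (?v i)"]) auto
    next
      case False
      then obtain i j where ij: "i \<le> ?N" "j \<le> ?N" "i \<noteq> j" "?v i = ?v j" by (auto simp: inj_on_def)
      let ?c = "\<lambda>k. (if k = i then 1 else 0) - (if k = j then 1 else 0 :: complex)"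
      have "(\<Sum>k\<le>?N. ?c k *s ?v k) = (\<Sum>k\<le>?N. if k = i then ?v k else 0) - (\<Sum>k\<le>?N. if k = j then ?v k else 0)"
        unfolding sum_subtractf[symmetric] by (intro sum.cong) auto
      also have "\<dots> = 0" using ij by simp
      finally show ?thesis using ij by (intro exI[of _ ?c]) auto
    qed
    then obtain c where c: "\<exists>i\<le>?N. c i \<noteq> 0" "(\<Sum>i\<le>?N. c i *s ?v i) = 0" by blast
    define p where "p = (\<Sum>i\<le>?N. Polynomial.monom (c i) i)"
    have cp: "Polynomial.coeff p k = (if k \<le> ?N then c k else 0)" for k
      unfolding p_def by (simp add: coeff_sum)
    have "Polynomial.degree p \<le> ?N" by (rule degree_le) (simp add: cp)
    have "(\<Sum>i\<le>Polynomial.degree p. Polynomial.coeff p i *s ?v i) = (\<Sum>i\<le>?N. Polynomial.coeff p i *s ?v i)"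
      using \<open>Polynomial.degree p \<le> ?N\<close> by (intro sum.mono_neutral_left) (auto simp: coeff_eq_0)
    also have "\<dots> = 0" using c(2) by (simp add: cp)
    finally show ?thesis using c(1) cp by (intro exI[of _ p]) (auto simp: poly_eq_iff)
  qed
  then show thesis
    using eigenvector_of_annihilating_poly[OF W w] that by blast
qed

text \<open>Stated for an arbitrary set of matrices, so that it applies alike to a group, its
  conjugate and the algebras spanned by them.\<close>

definition acts_irreducibly :: "('a::field ^ 'n ^ 'n) set \<Rightarrow> bool" where
  "acts_irreducibly \<Gamma> \<longleftrightarrow>
     (\<forall>W. vec.subspace W \<longrightarrow> (\<forall>A\<in>\<Gamma>. \<forall>x\<in>W. A *v x \<in> W) \<longrightarrow> W = {0} \<or> W = UNIV)"

lemma acts_irreduciblyD: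
  "acts_irreducibly \<Gamma> \<Longrightarrow> vec.subspace W \<Longrightarrow> (\<And>A x. A \<in> \<Gamma> \<Longrightarrow> x \<in> W \<Longrightarrow> A *v x \<in> W) \<Longrightarrow>
     W = {0} \<or> W = UNIV"
  unfolding acts_irreducibly_def by blast

text \<open>Scalars enter as scalar matrices; closure under scaling is then a case of closure under
  products.\<close>

definition matrix_subalgebra :: "('a::field ^ 'n ^ 'n) set \<Rightarrow> bool" where
  "matrix_subalgebra \<A> \<longleftrightarrow> (\<forall>c. mat c \<in> \<A>) \<and> (\<forall>A\<in>\<A>. \<forall>B\<in>\<A>. A + B \<in> \<A> \<and> A ** B \<in> \<A>)"

lemma matrix_subalgebraD:
  assumes "matrix_subalgebra \<A>"
  shows "mat c \<in> \<A>" "A \<in> \<A> \<Longrightarrow> B \<in> \<A> \<Longrightarrow> A + B \<in> \<A>" "A \<in> \<A> \<Longrightarrow> B \<in> \<A> \<Longrightarrow> A ** B \<in> \<A>"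
  using assms unfolding matrix_subalgebra_def by blast+

lemma matrix_subalgebra_diff:
  assumes "matrix_subalgebra \<A>" "A \<in> \<A>" "B \<in> \<A>"
  shows "A - B \<in> \<A>"
proof -
  have "A + mat (-1) ** B \<in> \<A>"
    using assms by (intro matrix_subalgebraD)
  also have "A + mat (-1) ** B = A - B"
    by (simp add: vec_eq_iff mat_mult_component)
  finally show ?thesis .
qed

lemma matrix_subalgebra_sum:
  assumes "matrix_subalgebra \<A>" "\<And>i. i \<in> I \<Longrightarrow> f i \<in> \<A>"
  shows "sum f I \<in> \<A>"
proof -
  \<comment> \<open>Zero is the value of the empty sum and also of a sum over an infinite
    set.\<close>
  have "mat 0 \<in> \<A>" using assms(1) by (rule matrix_subalgebraD)
  then show ?thesis using assms by (induction I rule: infinite_finite_induct) (auto intro: matrix_subalgebraD)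
qed

lemma kernel_subspace: "vec.subspace {x. (A :: 'a::field ^ 'n ^ 'm) *v x = 0}"
  unfolding vec.subspace_def by (auto simp: matrix_vector_right_distrib vector_scalar_commute)

text \<open>The vectors \<open>B *v x\<close> form an invariant subspace, which contains
  \<open>x\<close> and is therefore everything.\<close>

lemma irreducible_algebra_transitive:
  assumes A: "matrix_subalgebra \<A>" and irr: "acts_irreducibly \<A>" and x: "x \<noteq> 0"
  obtains B where "B \<in> \<A>" "B *v x = y"
proof -
  let ?W = "(\<lambda>B. B *v x) ` \<A>"
  have "vec.subspace ?W"
  proof (rule vec.subspaceI)
    have "mat 0 *v x \<in> ?W" using A by (intro imageI matrix_subalgebraD)
    then show "0 \<in> ?W" by simp
  next
    fix u v assume "u \<in> ?W" "v \<in> ?W"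
    then obtain B C where "B \<in> \<A>" "C \<in> \<A>" "u = B *v x" "v = C *v x" by blast
    then have "u + v = (B + C) *v x" "B + C \<in> \<A>"
      using A by (auto simp: matrix_vector_mult_add_rdistrib matrix_subalgebraD)
    then show "u + v \<in> ?W" by blast
  next
    fix c u assume "u \<in> ?W"
    then obtain B where "B \<in> \<A>" "u = B *v x" by blast
    then have "c *s u = (mat c ** B) *v x" "mat c ** B \<in> \<A>"
      using A by (auto simp: mat_mult_vector matrix_subalgebraD simp flip: matrix_vector_mul_assoc)
    then show "c *s u \<in> ?W" by blast
  qed
  moreover have "C *v u \<in> ?W" if "C \<in> \<A>" "u \<in> ?W" for C u
    using that A by (auto simp: matrix_vector_mul_assoc matrix_subalgebraD)
  ultimately have "?W = {0} \<or> ?W = UNIV" by (intro acts_irreduciblyD[OF irr]) auto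
  moreover have "mat 1 *v x \<in> ?W" using A by (intro imageI matrix_subalgebraD)
  ultimately have "?W = UNIV" using x by auto
  then have "y \<in> ?W" by blast
  then show thesis using that by blast
qed

text \<open>The matrix of rank at most one with column \<open>x\<close> and row \<open>f\<close>;
  \<open>f\<close> acts as a linear functional.\<close>

definition outer :: "'a::times ^ 'n \<Rightarrow> 'a ^ 'm \<Rightarrow> 'a ^ 'm ^ 'n" where
  "outer x f = (\<chi> i j. x $ i * f $ j)"

lemma matrix_mult_outer: "A ** outer x f = outer (A *v x) (f :: 'a::semiring_1 ^ 'n)"
  by (simp add: outer_def vec_eq_iff matrix_matrix_mult_def matrix_vector_mult_def sum_distrib_right mult.assoc)

lemma outer_mult_matrix: "outer x f ** A = outer x (f v* (A :: 'a::comm_semiring_1 ^ 'n ^ 'm))"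
  by (simp add: outer_def vec_eq_iff matrix_matrix_mult_def vector_matrix_mult_def sum_distrib_left ac_simps)

lemma outer_add_right: "outer x (f + g) = outer x f + outer x (g :: 'a::semiring ^ 'n)"
  by (simp add: outer_def vec_eq_iff distrib_left)

lemma trace_outer: "trace (outer x f) = (\<Sum>i\<in>UNIV. x $ i * f $ i)"
  by (simp add: trace_def outer_def)

text \<open>The Lomonosov--Rosenthal argument: a nonzero element \<open>T\<close> with largest kernel has rank one,
  since otherwise \<open>T A T - \<lambda> T\<close> would be a nonzero element with larger kernel, for a suitable
  \<open>A\<close> in the algebra and an eigenvalue \<open>\<lambda>\<close> of \<open>T A\<close> on the range of \<open>T\<close>.\<close>

lemma irreducible_algebra_rank_one:
  fixes \<A> :: "(complex ^ 'n ^ 'n) set"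
  assumes A: "matrix_subalgebra \<A>" and irr: "acts_irreducibly \<A>"
  obtains x f where "x \<noteq> 0" "f \<noteq> 0" "outer x f \<in> \<A>"
proof -
  let ?ker = "\<lambda>T :: complex ^ 'n ^ 'n. {x. T *v x = 0}"
  have one: "mat 1 \<in> \<A> \<and> (mat 1 :: complex ^ 'n ^ 'n) \<noteq> 0"
    using matrix_subalgebraD(1)[OF A] by (auto simp: vec_eq_iff mat_def)
  have "\<exists>T. (T \<in> \<A> \<and> T \<noteq> 0) \<and> (\<forall>T'. T' \<in> \<A> \<and> T' \<noteq> 0 \<longrightarrow> vec.dim (?ker T') \<le> vec.dim (?ker T))"
    using one by (rule ex_has_greatest_nat[of _ _ _ "CARD('n) + 1"])
      (auto simp: dim_subset_UNIV_cart_gen less_Suc_eq_le)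
  then obtain T where T: "T \<in> \<A>" "T \<noteq> 0"
    and max: "\<And>T'. T' \<in> \<A> \<Longrightarrow> T' \<noteq> 0 \<Longrightarrow> vec.dim (?ker T') \<le> vec.dim (?ker T)" by blast
  obtain z where z: "T *v z \<noteq> 0" using T(2) by (metis matrix_eq matrix_vector_mult_0)
  have rank_one: "\<exists>c. T *v y = c *s (T *v z)" for y
  proof (rule ccontr)
    assume *: "\<nexists>c. T *v y = c *s (T *v z)"
    obtain B where B: "B \<in> \<A>" "B *v (T *v z) = y" using irreducible_algebra_transitive[OF A irr z] .
    let ?TB = "T ** B"
    have "vec.subspace (range ((*v) T))"
      using vec.linear_subspace_image[OF matrix_vector_mul_linear_gen vec.subspace_UNIV] .
    moreover have "range ((*v) T) \<noteq> {0}" using z by auto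
    moreover have "?TB *v x \<in> range ((*v) T)" for x by (simp flip: matrix_vector_mul_assoc)
    ultimately obtain l v where v: "v \<in> range ((*v) T)" "v \<noteq> 0" "?TB *v v = l *s v"
      using eigenvector_in_invariant_subspace[of "range ((*v) T)" ?TB] by metis
    obtain u where u: "v = T *v u" using v(1) by blast
    define T' where "T' = ?TB ** T - mat l ** T"
    have T': "T' *v x = T *v (B *v (T *v x)) - l *s (T *v x)" for x
      unfolding T'_def by (simp add: matrix_vector_mult_diff_rdistrib mat_mult_vector flip: matrix_vector_mul_assoc)
    have "T' \<in> \<A>" unfolding T'_def
      using A B(1) T(1) by (intro matrix_subalgebra_diff matrix_subalgebraD(1,3))
    \<comment> \<open>Here \<open>T' *v z\<close> is \<open>T *v y\<close> minus a multiple of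
      \<open>T *v z\<close>, and \<open>y\<close> was chosen to make this nonzero.\<close>
    moreover have "T' *v z \<noteq> 0" using * by (auto simp: T' B(2))
    then have "T' \<noteq> 0" by auto
    ultimately have "vec.dim (?ker T') \<le> vec.dim (?ker T)" by (rule max)
    moreover have "vec.span (?ker T) \<subset> vec.span (?ker T')"
    proof -
      have "vec.span (?ker S) = ?ker S" for S :: "complex ^ 'n ^ 'n"
        using kernel_subspace by (simp add: vec.span_eq_iff)
      moreover have "?ker T \<subseteq> ?ker T'" by (auto simp: T')
      \<comment> \<open>The eigenvector is \<open>v = T *v u\<close>, so \<open>u\<close> is killed
        by \<open>T'\<close> although \<open>T *v u\<close> is nonzero.\<close>
      moreover have "u \<in> ?ker T'" "u \<notin> ?ker T"
        using u v by (auto simp: T' simp flip: matrix_vector_mul_assoc)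
      ultimately show ?thesis by blast
    qed
    then have "vec.dim (?ker T) < vec.dim (?ker T')" by (rule vec.dim_psubset)
    ultimately show False by simp
  qed
  then obtain c where c: "\<And>y. T *v y = c y *s (T *v z)" by metis
  define f :: "complex ^ 'n" where "f = (\<chi> j. c (axis j 1))"
  have "T $ i $ j = outer (T *v z) f $ i $ j" for i j
  proof -
    have "T $ i $ j = (T *v axis j 1) $ i" by (simp add: matrix_mult_axis column_def)
    also have "\<dots> = outer (T *v z) f $ i $ j" by (subst c) (simp add: outer_def f_def)
    finally show ?thesis .
  qed
  then have Tf: "T = outer (T *v z) f" by (simp add: vec_eq_iff)
  moreover have "f \<noteq> 0" using T(2) by (subst (asm) Tf) (auto simp: outer_def vec_eq_iff)
  ultimately show thesis using that[of "T *v z" f] z T(1) by simp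
qed

text \<open>A linear map that kills a basis of \<open>W\<close> and fixes some \<open>y\<close>
  outside \<open>W\<close> has a coordinate that is nonzero at \<open>y\<close>; the corresponding
  row of its matrix is \<open>z\<close>.\<close>

lemma separating_functional:
  fixes W :: "('a::field ^ 'n) set"
  assumes W: "vec.subspace W" "W \<noteq> UNIV"
  obtains z where "z \<noteq> 0" "\<And>f. f \<in> W \<Longrightarrow> (\<Sum>i\<in>UNIV. f $ i * z $ i) = 0"
proof -
  obtain y where y: "y \<notin> W" using W by blast
  obtain B where B: "B \<subseteq> W" "vec.independent B" "W \<subseteq> vec.span B"
    by (rule vec.basis_exists[of W]) blast
  have "vec.span B \<subseteq> W" using B(1) W(1) by (simp add: vec.span_minimal)
  then have "y \<notin> vec.span B" using y by blast
  then have "vec.independent (insert y B)" using B(2) by (simp add: vec.independent_insertI)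
  then obtain g :: "'a ^ 'n \<Rightarrow> 'a ^ 'n" where g: "Vector_Spaces.linear (*s) (*s) g"
      "\<And>x. x \<in> insert y B \<Longrightarrow> g x = (if x = y then y else 0)"
    using vec.linear_independent_extend[of "insert y B" "\<lambda>x. if x = y then y else 0"] by blast
  have gW: "g f = 0" if "f \<in> W" for f
    using vec.linear_eq_0_on_span[OF g(1), of B f] g(2) that B(3) \<open>y \<notin> vec.span B\<close> vec.span_base
    by (metis insertCI subsetD)
  have "y \<noteq> 0" using y vec.subspace_0[OF W(1)] by auto
  then obtain i where i: "y $ i \<noteq> 0" by (auto simp: vec_eq_iff)
  define z where "z = row i (matrix g)"
  have z: "(\<Sum>j\<in>UNIV. f $ j * z $ j) = g f $ i" for f
  proof -
    have "g f $ i = (matrix g *v f) $ i" by (simp add: matrix_works[OF g(1)])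
    then show ?thesis by (simp add: z_def row_def matrix_vector_mult_def mult.commute)
  qed
  show thesis
  proof (rule that[of z])
    show "z \<noteq> 0" using z[of y] i g(2)[of y] by auto
  qed (simp add: z gW)
qed

text \<open>The functionals \<open>g\<close> whose rank-one matrices all lie in the algebra form a
  subspace, which contains \<open>f v* B\<close> for all \<open>B\<close> in the algebra. If it were
  proper, a nonzero \<open>z\<close> would be killed by all of it; moving \<open>z\<close> to a
  basis vector on which \<open>f\<close> is nonzero contradicts this. The rank-one matrices span
  everything.\<close>

theorem burnside_matrix_algebra:
  fixes \<A> :: "(complex ^ 'n ^ 'n) set"
  assumes A: "matrix_subalgebra \<A>" and irr: "acts_irreducibly \<A>"
  shows "\<A> = UNIV"
proof -
  obtain x f where xf: "x \<noteq> 0" "f \<noteq> 0" "outer x f \<in> \<A>"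
    using irreducible_algebra_rank_one[OF A irr] .
  define F where "F = {g. \<forall>y. outer y g \<in> \<A>}"
  \<comment> \<open>Left multiplication by the algebra carries \<open>x\<close> to any
    \<open>y\<close>, so a single column vector decides membership in \<open>F\<close>.\<close>
  have F_I: "g \<in> F" if "outer x g \<in> \<A>" for g
  proof -
    have "outer y g \<in> \<A>" for y
    proof -
      obtain B where "B \<in> \<A>" "B *v x = y" using irreducible_algebra_transitive[OF A irr xf(1)] .
      then show ?thesis using matrix_subalgebraD(3)[OF A _ that, of B] by (simp add: matrix_mult_outer)
    qed
    then show ?thesis by (simp add: F_def)
  qed
  have subF: "vec.subspace F"
  proof (rule vec.subspaceI)
    have "outer x 0 = mat 0" by (simp add: outer_def vec_eq_iff)
    then show "0 \<in> F" using A by (intro F_I) (simp only: matrix_subalgebraD(1))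
    show "g + h \<in> F" if "g \<in> F" "h \<in> F" for g h
      using that A by (auto simp: F_def outer_add_right matrix_subalgebraD)
    show "c *s g \<in> F" if "g \<in> F" for c g
    proof -
      have "outer x (c *s g) = mat c ** outer x g"
        by (simp add: vec_eq_iff mat_mult_component outer_def)
      then show ?thesis using that A by (intro F_I) (simp add: F_def matrix_subalgebraD)
    qed
  qed
  have "F = UNIV"
  proof (rule ccontr)
    assume "F \<noteq> UNIV"
    then obtain z where z: "z \<noteq> 0" "\<And>g. g \<in> F \<Longrightarrow> (\<Sum>i\<in>UNIV. g $ i * z $ i) = 0"
      using separating_functional[OF subF] by blast
    obtain i where i: "f $ i \<noteq> 0" using xf(2) by (auto simp: vec_eq_iff)
    obtain B where B: "B \<in> \<A>" "B *v z = axis i 1" using irreducible_algebra_transitive[OF A irr z(1)] .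
    have "outer x (f v* B) \<in> \<A>"
      using matrix_subalgebraD(3)[OF A xf(3) B(1)] by (simp add: outer_mult_matrix)
    then have "(\<Sum>k\<in>UNIV. ((f v* B) $ k) * z $ k) = 0" by (intro z F_I)
    also have "(\<Sum>k\<in>UNIV. ((f v* B) $ k) * z $ k) = (\<Sum>j\<in>UNIV. f $ j * ((B *v z) $ j))"
      unfolding vector_matrix_mult_def matrix_vector_mult_def
      by (simp add: sum_distrib_left sum_distrib_right ac_simps) (rule sum.swap)
    also have "\<dots> = f $ i" by (simp add: B(2) axis_def if_distrib cong: if_cong)
    finally show False using i by simp
  qed
  have "M \<in> \<A>" for M
  proof -
    \<comment> \<open>Decomposition of \<open>M\<close> into its rows.\<close>
    have "M = (\<Sum>i\<in>UNIV. outer (axis i 1) (M $ i))"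
      by (simp add: vec_eq_iff outer_def axis_def if_distrib[of "\<lambda>t. t * _"] cong: if_cong)
    also have "\<dots> \<in> \<A>"
      using \<open>F = UNIV\<close> A by (intro matrix_subalgebra_sum) (auto simp: F_def)
    finally show ?thesis .
  qed
  then show ?thesis by blast
qed

section \<open>Irreducible representations with equal characters\<close>

lemma matrix_add_rdistrib: "(A + B) ** C = A ** C + B ** (C :: 'a::semiring_1 ^ 'n ^ 'm)"
  by (simp add: vec_eq_iff matrix_matrix_mult_def distrib_right sum.distrib)

lemma matrix_diff_ldistrib: "A ** (B - C) = A ** B - A ** (C :: 'a::ring_1 ^ 'n ^ 'm)"
  by (simp add: vec_eq_iff matrix_matrix_mult_def right_diff_distrib sum_subtractf)

lemma matrix_diff_rdistrib: "(A - B) ** C = A ** C - B ** (C :: 'a::ring_1 ^ 'n ^ 'm)"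
  by (simp add: vec_eq_iff matrix_matrix_mult_def left_diff_distrib sum_subtractf)

lemma acts_irreducibly_mono: "acts_irreducibly \<Gamma> \<Longrightarrow> \<Gamma> \<subseteq> \<Delta> \<Longrightarrow> acts_irreducibly \<Delta>"
  unfolding acts_irreducibly_def by blast

text \<open>Schur's lemma: an eigenspace of \<open>M\<close> is stable under all matrices that
  commute with \<open>M\<close>.\<close>

lemma irreducible_commutant_scalar:
  fixes \<Gamma> :: "(complex ^ 'n ^ 'n) set"
  assumes irr: "acts_irreducibly \<Gamma>" and comm: "\<And>A. A \<in> \<Gamma> \<Longrightarrow> A ** M = M ** A"
  obtains l where "M = mat l"
proof -
  \<comment> \<open>Any index serves; the vector only shows that the space is nonzero.\<close>
  have "axis undefined 1 \<noteq> (0 :: complex ^ 'n)" by (simp add: axis_eq_0_iff)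
  then have "UNIV \<noteq> {0 :: complex ^ 'n}" by auto
  then obtain l v where v: "v \<noteq> 0" "M *v v = l *s v"
    using eigenvector_in_invariant_subspace[of UNIV M, OF vec.subspace_UNIV] by blast
  let ?W = "{x. (M - mat l) *v x = 0}"
  have "A *v x \<in> ?W" if "A \<in> \<Gamma>" "x \<in> ?W" for A x
  proof -
    have "(M - mat l) *v (A *v x) = A *v ((M - mat l) *v x)"
      using comm[OF that(1)] mat_mult_commute[of A l]
      by (simp add: matrix_vector_mul_assoc matrix_diff_ldistrib matrix_diff_rdistrib)
    then show ?thesis using that(2) by simp
  qed
  then have "?W = {0} \<or> ?W = UNIV" by (rule acts_irreduciblyD[OF irr kernel_subspace])
  moreover have "v \<in> ?W" using v by (simp add: matrix_vector_mult_diff_rdistrib mat_mult_vector)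
  ultimately have "?W = UNIV" using v by auto
  then have "\<forall>x. M *v x = mat l *v x"
    by (auto simp: matrix_vector_mult_diff_rdistrib set_eq_iff)
  then show thesis using that matrix_eq by blast
qed

text \<open>The linear span of the graph of \<open>\<rho>\<close>. It is kept as a relation, because
  a linear extension of \<open>\<rho>\<close> is known to be well defined only after traces have
  been compared.\<close>

inductive_set joint_span ::
    "('a::field ^ 'n ^ 'n) set \<Rightarrow> ('a ^ 'n ^ 'n \<Rightarrow> 'a ^ 'm ^ 'm) \<Rightarrow> (('a ^ 'n ^ 'n) \<times> ('a ^ 'm ^ 'm)) set"
  for \<Gamma> \<rho> where
    zero: "(0, 0) \<in> joint_span \<Gamma> \<rho>"
  | step: "(M, N) \<in> joint_span \<Gamma> \<rho> \<Longrightarrow> A \<in> \<Gamma> \<Longrightarrow> (M + mat c ** A, N + mat c ** \<rho> A) \<in> joint_span \<Gamma> \<rho>"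

lemma joint_span_base: "A \<in> \<Gamma> \<Longrightarrow> (mat c ** A, mat c ** \<rho> A) \<in> joint_span \<Gamma> \<rho>"
  using joint_span.step[OF joint_span.zero, of A \<Gamma> c \<rho>] by simp

lemma joint_span_add:
  assumes "(M, N) \<in> joint_span \<Gamma> \<rho>" "(M', N') \<in> joint_span \<Gamma> \<rho>"
  shows "(M + M', N + N') \<in> joint_span \<Gamma> \<rho>"
  using assms(2)
proof (induction rule: joint_span.induct)
  case zero
  then show ?case using assms(1) by simp
next
  case (step M' N' A c)
  then show ?case using joint_span.step[OF step.IH step.hyps(2), of c] by (simp add: add.assoc)
qed

lemma joint_span_scale:
  assumes "(M, N) \<in> joint_span \<Gamma> \<rho>"
  shows "(mat d ** M, mat d ** N) \<in> joint_span \<Gamma> \<rho>"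
  using assms
proof (induction rule: joint_span.induct)
  case zero
  then show ?case by (simp add: joint_span.zero)
next
  case (step M N A c)
  then show ?case using joint_span.step[OF step.IH step.hyps(2), of "d * c"]
    by (simp add: matrix_add_ldistrib matrix_mul_assoc mat_mult_mat)
qed

lemma joint_span_sum:
  assumes "\<And>i. i \<in> I \<Longrightarrow> (f i, g i) \<in> joint_span \<Gamma> \<rho>"
  shows "(sum f I, sum g I) \<in> joint_span \<Gamma> \<rho>"
  using assms by (induction I rule: infinite_finite_induct) (auto intro: joint_span_add joint_span.zero)

lemma trace_mat_mult: "trace (mat c ** A) = c * trace (A :: 'a::semiring_1 ^ 'n ^ 'n)"
  by (simp add: trace_def mat_mult_component sum_distrib_left)

lemma joint_span_trace:
  assumes "(M, N) \<in> joint_span \<Gamma> \<rho>" "\<And>A. A \<in> \<Gamma> \<Longrightarrow> trace (\<rho> A) = trace A"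
  shows "trace N = trace M"
  using assms(1)
proof (induction rule: joint_span.induct)
  case zero
  then show ?case by (simp add: trace_def)
next
  case (step M N A c)
  then show ?case by (simp add: trace_add trace_mat_mult assms(2))
qed

text \<open>Multiplicativity of \<open>\<rho>\<close> extends bilinearly, by one induction for each
  factor.\<close>

lemma joint_span_mult:
  assumes mult: "\<And>A B. A \<in> \<Gamma> \<Longrightarrow> B \<in> \<Gamma> \<Longrightarrow> A ** B \<in> \<Gamma> \<and> \<rho> (A ** B) = \<rho> A ** \<rho> B"
    and MN: "(M, N) \<in> joint_span \<Gamma> \<rho>" and MN': "(M', N') \<in> joint_span \<Gamma> \<rho>"
  shows "(M ** M', N ** N') \<in> joint_span \<Gamma> \<rho>"
proof -
  have left: "(A ** M', \<rho> A ** N') \<in> joint_span \<Gamma> \<rho>" if "A \<in> \<Gamma>" for A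
    using MN'
  proof (induction rule: joint_span.induct)
    case zero
    then show ?case by (simp add: joint_span.zero)
  next
    case (step M N B c)
    have "A ** (mat c ** B) = mat c ** (A ** B)" "\<rho> A ** (mat c ** \<rho> B) = mat c ** (\<rho> A ** \<rho> B)"
      by (metis mat_mult_commute matrix_mul_assoc)+
    then show ?case
      using joint_span.step[OF step.IH, of "A ** B" c] mult[OF that step.hyps(2)]
      by (simp add: matrix_add_ldistrib)
  qed
  show ?thesis using MN
  proof (induction rule: joint_span.induct)
    case zero
    then show ?case by (simp add: joint_span.zero)
  next
    case (step M N A c)
    then show ?case using joint_span_add[OF step.IH joint_span_scale[OF left[OF step.hyps(2)], of c]]
      by (simp add: matrix_add_rdistrib matrix_mul_assoc)
  qed
qed

text \<open>Prepares both projections of the span for Burnside's theorem.\<close>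

lemma matrix_subalgebra_joint_span:
  assumes mult: "\<And>A B. A \<in> \<Gamma> \<Longrightarrow> B \<in> \<Gamma> \<Longrightarrow> A ** B \<in> \<Gamma> \<and> \<rho> (A ** B) = \<rho> A ** \<rho> B"
    and one: "mat 1 \<in> \<Gamma>" "\<rho> (mat 1) = mat 1"
  shows "matrix_subalgebra (fst ` joint_span \<Gamma> \<rho>)" "matrix_subalgebra (snd ` joint_span \<Gamma> \<rho>)"
proof -
  have "(mat c, mat c) \<in> joint_span \<Gamma> \<rho>" for c
    using joint_span_base[OF one(1), of c \<rho>] one(2) by simp
  moreover have "(M + M', N + N') \<in> joint_span \<Gamma> \<rho> \<and> (M ** M', N ** N') \<in> joint_span \<Gamma> \<rho>"
    if "(M, N) \<in> joint_span \<Gamma> \<rho>" "(M', N') \<in> joint_span \<Gamma> \<rho>" for M N M' N'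
    using joint_span_add[OF that] joint_span_mult[OF mult that] by blast
  moreover have "fst ` joint_span \<Gamma> \<rho> = {M. \<exists>N. (M, N) \<in> joint_span \<Gamma> \<rho>}"
    "snd ` joint_span \<Gamma> \<rho> = {N. \<exists>M. (M, N) \<in> joint_span \<Gamma> \<rho>}" by force+
  ultimately show "matrix_subalgebra (fst ` joint_span \<Gamma> \<rho>)" "matrix_subalgebra (snd ` joint_span \<Gamma> \<rho>)"
    unfolding matrix_subalgebra_def by (simp_all, blast+)
qed

text \<open>Testing against a matrix unit reads off a single entry.\<close>

lemma trace_form_nondegenerate:
  fixes N :: "'a::field ^ 'n ^ 'n"
  assumes "\<And>L. trace (N ** L) = 0"
  shows "N = 0"
proof -
  have "N $ i $ j = 0" for i j
  proof -
    have "trace (N ** outer (axis j 1) (axis i 1)) = N $ i $ j"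
      by (simp add: matrix_mult_outer trace_outer matrix_mult_axis)
        (simp add: column_def axis_def if_distrib cong: if_cong)
    then show ?thesis using assms by simp
  qed
  then show ?thesis by (simp add: vec_eq_iff)
qed

text \<open>By Burnside's theorem, \<open>A \<mapsto> \<rho> A\<close> extends linearly to an automorphism of the full matrix
  algebra, which is well defined because the trace form is nondegenerate. It is inner: if \<open>F\<^sub>i\<close> denotes
  the image of the matrix unit \<open>E\<^sub>i\<^sub>1\<close>, then the conjugating matrix maps \<open>e\<^sub>i\<close> to \<open>F\<^sub>i v\<close> for some \<open>v\<close>.\<close>

theorem irreducible_equal_traces_equivalent:
  fixes \<Gamma> :: "(complex ^ 'n ^ 'n) set" and \<rho> :: "complex ^ 'n ^ 'n \<Rightarrow> complex ^ 'n ^ 'n"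
  assumes mult: "\<And>A B. A \<in> \<Gamma> \<Longrightarrow> B \<in> \<Gamma> \<Longrightarrow> A ** B \<in> \<Gamma> \<and> \<rho> (A ** B) = \<rho> A ** \<rho> B"
    and one: "mat 1 \<in> \<Gamma>" "\<rho> (mat 1) = mat 1"
    and irr: "acts_irreducibly \<Gamma>" "acts_irreducibly (\<rho> ` \<Gamma>)"
    and tr: "\<And>A. A \<in> \<Gamma> \<Longrightarrow> trace (\<rho> A) = trace A"
  obtains S where "invertible S" "\<And>A. A \<in> \<Gamma> \<Longrightarrow> S ** A = \<rho> A ** S"
proof -
  let ?P = "joint_span \<Gamma> \<rho>"
  have base: "(A, \<rho> A) \<in> ?P" if "A \<in> \<Gamma>" for A
    using joint_span_base[OF that, of 1 \<rho>] by simp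
  have "\<Gamma> \<subseteq> fst ` ?P" "\<rho> ` \<Gamma> \<subseteq> snd ` ?P" using base by force+
  then have surj: "fst ` ?P = UNIV" "snd ` ?P = UNIV"
    using matrix_subalgebra_joint_span[OF mult one] irr
    by (auto intro!: burnside_matrix_algebra intro: acts_irreducibly_mono simp del: fst_conv snd_conv)
  \<comment> \<open>Any \<open>L\<close> has a partner \<open>K\<close> in the span, and both
    \<open>trace (N ** L)\<close> and \<open>trace (N' ** L)\<close> equal
    \<open>trace (M ** K)\<close>.\<close>
  have unique: "N = N'" if "(M, N) \<in> ?P" "(M, N') \<in> ?P" for M N N'
  proof -
    have "trace ((N - N') ** L) = 0" for L
    proof -
      have "L \<in> snd ` ?P" using surj by simp
      then obtain K where KL: "(K, L) \<in> ?P" by auto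
      have "trace (N ** L) = trace (M ** K)" "trace (N' ** L) = trace (M ** K)"
        using that KL by (auto intro!: joint_span_trace[OF _ tr] joint_span_mult[OF mult])
      then show ?thesis by (simp add: matrix_diff_rdistrib trace_sub)
    qed
    then have "N - N' = 0" by (rule trace_form_nondegenerate)
    then show ?thesis by simp
  qed
  \<comment> \<open>An arbitrary fixed column index, in the role of 1 in the matrix units.\<close>
  define k :: 'n where "k = undefined"
  let ?E = "\<lambda>i. outer (axis i 1) (axis k 1) :: complex ^ 'n ^ 'n"
  have "\<exists>N. (?E i, N) \<in> ?P" for i
  proof -
    have "?E i \<in> fst ` ?P" using surj by simp
    then show ?thesis by auto
  qed
  then obtain F where F: "\<And>i. (?E i, F i) \<in> ?P" by metis
  \<comment> \<open>The diagonal matrix unit has trace 1, which its image inherits; hence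
    \<open>F k\<close> is nonzero.\<close>
  have "trace (F k) = trace (?E k)" by (rule joint_span_trace[OF F tr])
  also have "\<dots> = 1" by (simp add: trace_outer) (simp add: axis_def if_distrib[of "\<lambda>t. t * _"] cong: if_cong)
  finally have "F k \<noteq> 0" by (auto simp: trace_def)
  then obtain v where v: "F k *v v \<noteq> 0" by (metis matrix_eq matrix_vector_mult_0)
  define S :: "complex ^ 'n ^ 'n" where "S = (\<chi> i j. (F j *v v) $ i)"
  have S: "S *v axis j 1 = F j *v v" for j
    by (simp add: S_def matrix_mult_axis) (simp add: column_def vec_eq_iff)
  have SA: "S ** A = \<rho> A ** S" if A: "A \<in> \<Gamma>" for A
  proof -
    have "(S ** A) *v axis j 1 = (\<rho> A ** S) *v axis j 1" for j
    proof -
      have Aj: "A *v axis j 1 = (\<Sum>i\<in>UNIV. A $ i $ j *s axis i 1)"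
        by (simp add: matrix_mult_axis) (simp add: vec_eq_iff column_def axis_def if_distrib cong: if_cong)
      have "A ** ?E j = outer (column j A) (axis k 1)"
        by (simp add: matrix_mult_outer matrix_mult_axis)
      also have "\<dots> = (\<Sum>i\<in>UNIV. mat (A $ i $ j) ** ?E i)"
      proof -
        have "outer (column j A) (axis k 1) $ a $ b = (\<Sum>i\<in>UNIV. mat (A $ i $ j) ** ?E i) $ a $ b" for a b
        proof -
          have "A $ a $ j = (\<Sum>i\<in>UNIV. A $ i $ j * axis i 1 $ a)"
            by (simp add: axis_def if_distrib cong: if_cong)
          then have "outer (column j A) (axis k 1) $ a $ b = (\<Sum>i\<in>UNIV. A $ i $ j * axis i 1 $ a) * axis k 1 $ b"
            by (simp add: outer_def column_def)
          then show ?thesis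
            by (simp add: mat_mult_component outer_def sum_distrib_right mult.assoc)
        qed
        then show ?thesis by (simp only: vec_eq_iff) blast
      qed
      finally have AE: "A ** ?E j = (\<Sum>i\<in>UNIV. mat (A $ i $ j) ** ?E i)" .
      have *: "(\<Sum>i\<in>UNIV. mat (A $ i $ j) ** ?E i, \<Sum>i\<in>UNIV. mat (A $ i $ j) ** F i) \<in> ?P"
        by (intro joint_span_sum joint_span_scale F)
      \<comment> \<open>Column \<open>j\<close> of \<open>A\<close> expands \<open>A ** ?E j\<close>
        in the matrix units; by uniqueness their images satisfy the same relation, which applied to
        \<open>v\<close> is the intertwining identity on the basis vector
        \<open>axis j 1\<close>.\<close>
      have "(A ** ?E j, \<rho> A ** F j) \<in> ?P"
        by (rule joint_span_mult[OF mult base[OF A] F])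
      then have *: "\<rho> A ** F j = (\<Sum>i\<in>UNIV. mat (A $ i $ j) ** F i)"
        unfolding AE using * by (rule unique)
      have "(S ** A) *v axis j 1 = S *v (\<Sum>i\<in>UNIV. A $ i $ j *s axis i 1)"
        by (simp add: Aj flip: matrix_vector_mul_assoc)
      also have "\<dots> = (\<Sum>i\<in>UNIV. A $ i $ j *s (F i *v v))"
        by (simp add: vec.linear_sum[OF matrix_vector_mul_linear_gen] matrix_vector_mult_smult S)
      also have "\<dots> = (\<Sum>i\<in>UNIV. mat (A $ i $ j) ** F i) *v v"
        by (simp add: vec_eq_iff matrix_vector_mult_def mat_mult_component sum_distrib_left sum_distrib_right mult.assoc)
          (intro allI sum.swap)
      also have "\<dots> = (\<rho> A ** S) *v axis j 1"
        unfolding *[symmetric] by (simp add: S flip: matrix_vector_mul_assoc)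
      finally show ?thesis .
    qed
    then show ?thesis by (simp add: matrix_mult_axis) (simp add: vec_eq_iff column_def)
  qed
  \<comment> \<open>The kernel of the intertwiner is invariant and misses \<open>axis k 1\<close>,
    so it is zero.\<close>
  let ?W = "{x. S *v x = 0}"
  have "A *v x \<in> ?W" if "A \<in> \<Gamma>" "x \<in> ?W" for A x
    using SA[OF that(1)] that(2) by (simp add: matrix_vector_mul_assoc) (simp flip: matrix_vector_mul_assoc)
  then have "?W = {0} \<or> ?W = UNIV" by (rule acts_irreduciblyD[OF irr(1) kernel_subspace])
  moreover have "axis k 1 \<notin> ?W" using S[of k] v by simp
  ultimately have "?W = {0}" by blast
  then have "invertible S"
    unfolding invertible_left_inverse matrix_left_invertible_ker by blast
  then show thesis using that SA by blast
qed

section \<open>Complex conjugation and invariant bilinear forms\<close>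

definition cnj_vec :: "complex ^ 'n \<Rightarrow> complex ^ 'n" where
  "cnj_vec z = (\<chi> i. cnj (z $ i))"

definition cnj_matrix :: "complex ^ 'n ^ 'm \<Rightarrow> complex ^ 'n ^ 'm" where
  "cnj_matrix A = (\<chi> i j. cnj (A $ i $ j))"

lemma cnj_vec_simps [simp]:
  "cnj_vec (cnj_vec z) = z" "cnj_vec 0 = 0" "cnj_vec (z + w) = cnj_vec z + cnj_vec w"
  "cnj_vec (z - w) = cnj_vec z - cnj_vec w" "cnj_vec (c *s z) = cnj c *s cnj_vec z"
  by (simp_all add: cnj_vec_def vec_eq_iff)

lemma cnj_matrix_simps [simp]:
  "cnj_matrix (cnj_matrix A) = A" "cnj_matrix (A ** B) = cnj_matrix A ** cnj_matrix B"
  "cnj_matrix (mat c) = mat (cnj c)" "cnj_matrix (transpose A) = transpose (cnj_matrix A)"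
  "cnj_vec (A *v z) = cnj_matrix A *v cnj_vec z"
  by (simp_all add: cnj_matrix_def cnj_vec_def vec_eq_iff matrix_matrix_mult_def matrix_vector_mult_def
      mat_def transpose_def)

lemma det_cnj_matrix: "det (cnj_matrix A) = cnj (det A)"
  by (simp add: det_def cnj_matrix_def)

lemma trace_cnj_matrix: "trace (cnj_matrix A) = cnj (trace A)"
  by (simp add: trace_def cnj_matrix_def)

lemma det_mat: "det (mat c :: 'a::comm_ring_1 ^ 'n ^ 'n) = c ^ CARD('n)"
  by (subst det_diagonal) (simp_all add: mat_def)

lemma mat_eq_iff: "mat a = (mat b :: 'a::zero ^ 'n ^ 'n) \<longleftrightarrow> a = b"
proof
  assume "mat a = (mat b :: 'a ^ 'n ^ 'n)"
  then have "(mat a :: 'a ^ 'n ^ 'n) $ undefined $ undefined = (mat b :: 'a ^ 'n ^ 'n) $ undefined $ undefined"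
    by (rule arg_cong)
  then show "a = b" by (simp add: mat_def)
qed simp

text \<open>Conjugating the entries of its vectors turns a subspace invariant under the conjugate
  set into a complex subspace invariant under \<open>\<Gamma>\<close>.\<close>

lemma acts_irreducibly_cnj:
  assumes "acts_irreducibly \<Gamma>"
  shows "acts_irreducibly (cnj_matrix ` \<Gamma>)"
  unfolding acts_irreducibly_def
proof (intro allI impI)
  fix W :: "(complex ^ 'a) set"
  assume W: "vec.subspace W" "\<forall>A\<in>cnj_matrix ` \<Gamma>. \<forall>x\<in>W. A *v x \<in> W"
  let ?V = "{x. cnj_vec x \<in> W}"
  have "vec.subspace ?V"
    using W(1) by (auto simp: vec.subspace_def)
  then have "?V = {0} \<or> ?V = UNIV"
    by (rule acts_irreduciblyD[OF assms]) (use W(2) in auto)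
  moreover have "W = cnj_vec ` ?V"
    by (auto simp: image_iff) (metis cnj_vec_simps(1))
  moreover have "surj (cnj_vec :: complex ^ 'a \<Rightarrow> _)"
    by (metis cnj_vec_simps(1) surjI)
  ultimately show "W = {0} \<or> W = UNIV" by auto
qed

text \<open>The inverse of \<open>N\<close> times \<open>transpose N\<close> commutes with
  \<open>\<Gamma>\<close>, so \<open>transpose N\<close> is \<open>l\<close> times \<open>N\<close>.
  Transposing twice gives \<open>l * l = 1\<close>, determinants give
  \<open>l ^ CARD('n) = 1\<close>, and an odd exponent leaves \<open>l = 1\<close>.\<close>

lemma irreducible_invariant_bilinear_symmetric:
  fixes \<Gamma> :: "(complex ^ 'n ^ 'n) set"
  assumes irr: "acts_irreducibly \<Gamma>" and odd: "odd CARD('n)" and N: "det N \<noteq> 0"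
    and inv: "\<And>A. A \<in> \<Gamma> \<Longrightarrow> transpose A ** N ** A = N"
  shows "transpose N = N"
proof -
  obtain K where K: "K ** N = mat 1" "N ** K = mat 1"
    using N by (auto simp: invertible_det_nz[symmetric] invertible_def)
  have "A ** (K ** transpose N) = (K ** transpose N) ** A" if A: "A \<in> \<Gamma>" for A
  proof -
    have "det (transpose A ** N ** A) = det N" using inv[OF A] by simp
    then have "det A \<noteq> 0" using N by (auto simp: det_mul)
    then have "invertible (transpose A)" by (simp add: invertible_det_nz)
    then obtain B where B: "B ** transpose A = mat 1" by (auto simp: invertible_def)
    \<comment> \<open>Invariance means that \<open>N\<close>, and likewise its transpose,
      intertwines \<open>A\<close> with the inverse transpose \<open>B\<close>.\<close>
    have NA: "N ** A = B ** N"
      using inv[OF A] by (metis B matrix_mul_assoc matrix_mul_lid)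
    have "transpose (transpose A ** N ** A) = transpose N" using inv[OF A] by simp
    then have "transpose A ** transpose N ** A = transpose N"
      by (simp add: matrix_transpose_mul matrix_mul_assoc)
    then have NTA: "transpose N ** A = B ** transpose N"
      by (metis B matrix_mul_assoc matrix_mul_lid)
    have AK: "A ** K = K ** B"
      by (metis NA K matrix_mul_assoc matrix_mul_lid matrix_mul_rid)
    show ?thesis by (metis AK NTA matrix_mul_assoc)
  qed
  then obtain l where l: "K ** transpose N = mat l"
    using irreducible_commutant_scalar[OF irr] by metis
  have NT: "transpose N = mat l ** N"
    using l K by (metis mat_mult_commute matrix_mul_assoc matrix_mul_lid)
  then have "det (transpose N) = l ^ CARD('n) * det N" by (simp add: det_mul det_mat)
  then have ln: "l ^ CARD('n) = 1" using N by simp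
  have "N = transpose (mat l ** N)" by (simp flip: NT)
  also have "\<dots> = mat l ** transpose N"
    by (simp add: matrix_transpose_mul mat_mult_commute[of "transpose N"])
  also have "\<dots> = mat l ** (mat l ** N)" by (simp only: NT)
  finally have "N = mat l ** (mat l ** N)" .
  then have "N = mat (l * l) ** N"
    by (simp add: matrix_mul_assoc mat_mult_mat)
  then have "mat (l * l) = (mat 1 :: complex ^ 'n ^ 'n)"
    using K by (metis matrix_mul_assoc matrix_mul_rid)
  then have "l * l = 1" by (simp only: mat_eq_iff)
  moreover obtain k where "CARD('n) = Suc (2 * k)" using odd by (auto elim: oddE)
  ultimately have "l = 1" using ln by (simp add: power_mult power2_eq_square)
  then show ?thesis using NT by simp
qed

text \<open>By Schur, \<open>cnj_matrix S ** S\<close> is a scalar \<open>l\<close>, which turns out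
  to be real. Its power \<open>l ^ CARD('n)\<close> is the squared modulus of \<open>det S\<close>,
  so \<open>l\<close> is positive in odd dimension and \<open>S\<close> can be divided by its square
  root.\<close>

lemma irreducible_conj_intertwiner:
  fixes \<Gamma> :: "(complex ^ 'n ^ 'n) set"
  assumes irr: "acts_irreducibly \<Gamma>" and odd: "odd CARD('n)"
    and S: "invertible S" "\<And>A. A \<in> \<Gamma> \<Longrightarrow> S ** A = cnj_matrix A ** S"
  obtains T where "invertible T" "\<And>A. A \<in> \<Gamma> \<Longrightarrow> T ** A = cnj_matrix A ** T" "cnj_matrix T ** T = mat 1"
proof -
  have S': "cnj_matrix S ** cnj_matrix A = A ** cnj_matrix S" if "A \<in> \<Gamma>" for A
    using arg_cong[OF S(2)[OF that], of cnj_matrix] by simp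
  have "A ** (cnj_matrix S ** S) = (cnj_matrix S ** S) ** A" if "A \<in> \<Gamma>" for A
    using S(2)[OF that] S'[OF that] by (metis matrix_mul_assoc)
  then obtain l where l: "cnj_matrix S ** S = mat l"
    using irreducible_commutant_scalar[OF irr] by metis
  have "S ** cnj_matrix S = mat (cnj l)"
    using arg_cong[OF l, of cnj_matrix] by simp
  \<comment> \<open>Two bracketings of \<open>S ** cnj_matrix S ** S\<close>.\<close>
  then have "mat (cnj l) ** S = S ** mat l" using l by (metis matrix_mul_assoc)
  then have "mat (cnj l) ** S = mat l ** S" by (simp add: mat_mult_commute)
  then have "mat (cnj l) = (mat l :: complex ^ 'n ^ 'n)"
    using S(1) unfolding invertible_def by (metis matrix_mul_assoc matrix_mul_rid)
  then have "cnj l = l" by (simp only: mat_eq_iff)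
  then obtain r where r: "l = of_real r" by (metis Reals_cases Reals_cnj_iff)
  have "det (cnj_matrix S ** S) = l ^ CARD('n)" unfolding l by (rule det_mat)
  then have "of_real (r ^ CARD('n)) = cnj (det S) * det S" by (simp add: r det_mul det_cnj_matrix)
  also have "\<dots> = of_real ((cmod (det S))\<^sup>2)" by (metis complex_norm_square mult.commute)
  finally have "r ^ CARD('n) = (cmod (det S))\<^sup>2" by (simp only: of_real_eq_iff)
  moreover have "det S \<noteq> 0" using S(1) by (simp add: invertible_det_nz)
  ultimately have "r ^ CARD('n) > 0" by simp
  then have "r > 0" using odd by (simp add: zero_less_power_eq)
  define c where "c = complex_of_real (1 / sqrt r)"
  have c: "cnj c = c" "c * c * l = 1" "c \<noteq> 0"
    using \<open>r > 0\<close> by (auto simp: c_def r simp flip: of_real_mult)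
  show thesis
  proof (rule that[of "mat c ** S"])
    have "det (mat c ** S) \<noteq> 0" using c(3) \<open>det S \<noteq> 0\<close> by (simp add: det_mul det_mat)
    then show "invertible (mat c ** S)" by (simp add: invertible_det_nz)
    show "mat c ** S ** A = cnj_matrix A ** (mat c ** S)" if "A \<in> \<Gamma>" for A
      using S(2)[OF that] by (metis mat_mult_commute matrix_mul_assoc)
    have "cnj_matrix (mat c ** S) ** (mat c ** S) = mat c ** (mat c ** (cnj_matrix S ** S))"
      using c(1) by simp (metis mat_mult_commute matrix_mul_assoc)
    also have "\<dots> = mat 1" using c(2) by (simp add: l mat_mult_mat mult.assoc)
    finally show "cnj_matrix (mat c ** S) ** (mat c ** S) = mat 1" .
  qed
qed

section \<open>Real structures compatible with the Hermitian form\<close>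

text \<open>The Gram matrix of \<open>herm\<close> in the standard basis, with ones on the
  antidiagonal.\<close>

definition herm_form :: "complex ^ 3 ^ 3" where
  "herm_form = vector [axis 3 1, axis 2 1, axis 1 1]"

lemma herm_form_component:
  "herm_form $ 1 = axis 3 1" "herm_form $ 2 = axis 2 1" "herm_form $ 3 = axis 1 1"
  by (simp_all add: herm_form_def)

lemma axis_component:
  "axis k 1 $ i = (if i = k then 1 else (0 :: complex))"
  by (simp add: axis_def)

lemma herm_alt: "herm z w = (\<Sum>i\<in>UNIV. z $ i * (herm_form *v cnj_vec w) $ i)"
  by (simp add: herm_def sum_3 matrix_vector_mult_def herm_form_component axis_component cnj_vec_def)

lemma gram_matrix:
  "(transpose A ** herm_form ** cnj_matrix B) $ i $ j = herm (column i A) (column j B)"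
  by (simp add: herm_def sum_3 matrix_matrix_mult_def transpose_def herm_form_component axis_component
      cnj_matrix_def column_def algebra_simps)

lemma herm_simps:
  "herm (z + z') w = herm z w + herm z' w" "herm z (w + w') = herm z w + herm z w'"
  "herm (z - z') w = herm z w - herm z' w" "herm z (w - w') = herm z w - herm z w'"
  "herm (c *s z) w = c * herm z w" "herm z (c *s w) = cnj c * herm z w"
  by (simp_all add: herm_def algebra_simps)

lemma cnj_herm: "cnj (herm z w) = herm w z"
  by (simp add: herm_def algebra_simps)

text \<open>Turns the isometry condition into a matrix identity, into which intertwining relations
  can be substituted.\<close>

lemma herm_preserving_iff:
  "(\<forall>z w. herm (A *v z) (A *v w) = herm z w) \<longleftrightarrow> transpose A ** herm_form ** cnj_matrix A = herm_form"
proof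
  assume *: "\<forall>z w. herm (A *v z) (A *v w) = herm z w"
  have "herm (column i A) (column j A) = herm (axis i 1) (axis j 1)" for i j
    using * by (simp flip: matrix_mult_axis)
  moreover have "herm (axis i 1) (axis j 1) = herm_form $ i $ j" for i j
  proof -
    have "herm (axis i 1) (axis j 1) = herm (column i (mat 1)) (column j (mat 1))"
      by (simp flip: matrix_mult_axis)
    also have "\<dots> = (transpose (mat 1) ** herm_form ** cnj_matrix (mat 1)) $ i $ j"
      by (simp only: gram_matrix)
    finally show ?thesis by simp
  qed
  ultimately show "transpose A ** herm_form ** cnj_matrix A = herm_form"
    by (simp add: vec_eq_iff gram_matrix)
next
  assume *: "transpose A ** herm_form ** cnj_matrix A = herm_form"
  have adj: "(\<Sum>i\<in>UNIV. (A *v z) $ i * u $ i) = (\<Sum>i\<in>UNIV. z $ i * (transpose A *v u) $ i)" for z u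
    by (simp add: sum_3 matrix_vector_mult_def transpose_def algebra_simps)
  show "\<forall>z w. herm (A *v z) (A *v w) = herm z w"
  proof (intro allI)
    fix z w
    have "herm (A *v z) (A *v w) = (\<Sum>i\<in>UNIV. z $ i * ((transpose A ** herm_form ** cnj_matrix A) *v cnj_vec w) $ i)"
      unfolding herm_alt adj by (simp add: matrix_vector_mul_assoc matrix_mul_assoc del: transpose_matrix_vector)
    then show "herm (A *v z) (A *v w) = herm z w" by (simp only: * herm_alt)
  qed
qed

lemma det_herm_form: "det herm_form = -1"
  by (simp add: det_3 herm_form_component axis_component)

lemma symmetric_bilinear_commute:
  fixes N :: "'a::comm_ring_1 ^ 'n ^ 'n"
  assumes "transpose N = N"
  shows "(\<Sum>i\<in>UNIV. z $ i * (N *v w) $ i) = (\<Sum>i\<in>UNIV. w $ i * (N *v z) $ i)"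
proof -
  have "N $ i $ j = N $ j $ i" for i j
    using arg_cong[OF assms, of "\<lambda>M. M $ i $ j"] by (simp add: transpose_def)
  then have "(\<Sum>i\<in>UNIV. z $ i * (N *v w) $ i) = (\<Sum>i\<in>UNIV. \<Sum>j\<in>UNIV. w $ j * (N $ j $ i * z $ i))"
    by (simp add: matrix_vector_mult_def sum_distrib_left ac_simps)
  also have "\<dots> = (\<Sum>j\<in>UNIV. \<Sum>i\<in>UNIV. w $ j * (N $ j $ i * z $ i))" by (rule sum.swap)
  finally show ?thesis by (simp add: matrix_vector_mult_def sum_distrib_left)
qed

text \<open>The first condition makes \<open>z \<mapsto> cnj_vec (S *v z)\<close> an antilinear
  involution, whose fixed vectors are the real vectors below. The second makes the Hermitian form
  symmetric, hence real-valued, on them.\<close>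

locale real_structure =
  fixes S :: "complex ^ 3 ^ 3"
  assumes involution: "cnj_matrix S ** S = mat 1"
    and symmetric: "transpose (herm_form ** S) = herm_form ** S"
begin

definition real_vector :: "complex ^ 3 \<Rightarrow> bool" where
  "real_vector z \<longleftrightarrow> S *v z = cnj_vec z"

lemma involution': "S ** cnj_matrix S = mat 1"
  using arg_cong[OF involution, of cnj_matrix] by simp

lemma real_vector_simps:
  "real_vector z \<Longrightarrow> real_vector w \<Longrightarrow> real_vector (z + w)"
  "real_vector z \<Longrightarrow> real_vector w \<Longrightarrow> real_vector (z - w)"
  "real_vector z \<Longrightarrow> real_vector (of_real r *s z)"
  by (simp_all add: real_vector_def matrix_vector_right_distrib matrix_vector_mult_diff_distrib
      matrix_vector_mult_smult)

lemma herm_real_vector: "real_vector w \<Longrightarrow> herm z w = (\<Sum>i\<in>UNIV. z $ i * ((herm_form ** S) *v w) $ i)"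
  by (simp add: herm_alt real_vector_def flip: matrix_vector_mul_assoc)

lemma herm_real_vectors: "real_vector z \<Longrightarrow> real_vector w \<Longrightarrow> herm z w = herm w z"
  using symmetric_bilinear_commute[OF symmetric] by (simp add: herm_real_vector)

definition conj_vec :: "complex ^ 3 \<Rightarrow> complex ^ 3" where
  "conj_vec z = cnj_matrix S *v cnj_vec z"

lemma S_conj_vec: "S *v conj_vec z = cnj_vec z" "cnj_vec (conj_vec z) = S *v z"
  by (simp_all add: conj_vec_def matrix_vector_mul_assoc involution')

text \<open>Consequently the real and imaginary parts of a vector orthogonal to a real vector
  \<open>w\<close> are again orthogonal to \<open>w\<close>.\<close>

lemma herm_conj_vec: "real_vector w \<Longrightarrow> herm (conj_vec z) w = cnj (herm z w)"
proof -
  assume w: "real_vector w"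
  have "herm (conj_vec z) w = (\<Sum>i\<in>UNIV. w $ i * ((herm_form ** S) *v conj_vec z) $ i)"
    using symmetric_bilinear_commute[OF symmetric] w by (simp add: herm_real_vector)
  also have "(herm_form ** S) *v conj_vec z = herm_form *v cnj_vec z"
    by (simp add: S_conj_vec flip: matrix_vector_mul_assoc)
  finally show ?thesis by (simp add: cnj_herm flip: herm_alt)
qed

text \<open>Splitting a vector into its real and imaginary part with respect to the real structure: the
  values of the form add up, so one of the two parts has the sign of the given vector.\<close>

lemma real_vector_of_sign:
  assumes s: "s = 1 \<or> s = -1" and z: "s * Re (herm z z) > 0"
    and K: "\<And>w. w \<in> K \<Longrightarrow> real_vector w \<and> herm z w = 0"
  obtains x where "real_vector x" "\<And>w. w \<in> K \<Longrightarrow> herm x w = 0" "herm x x = of_real s"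
proof -
  define x where "x = (1/2) *s (z + conj_vec z)"
  define y where "y = (- \<i>/2) *s (z - conj_vec z)"
  have real: "real_vector x" "real_vector y"
    unfolding real_vector_def x_def y_def
    by (simp_all add: matrix_vector_mult_smult matrix_vector_right_distrib matrix_vector_mult_diff_distrib
        S_conj_vec add.commute vec.scale_right_diff_distrib)
  have orth: "herm x w = 0 \<and> herm y w = 0" if "w \<in> K" for w
    using K[OF that] by (simp add: x_def y_def herm_simps herm_conj_vec)
  have zxy: "z = x + \<i> *s y"
    by (simp add: x_def y_def vec_eq_iff field_simps)
  \<comment> \<open>The cross terms cancel, because \<open>herm x y = herm y x\<close> for real
    vectors.\<close>
  have "herm z z = herm x x + herm y y"
    unfolding zxy by (simp add: herm_simps herm_real_vectors[OF real(2,1)] algebra_simps)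
  then have "s * Re (herm x x) + s * Re (herm y y) > 0"
    using z by (simp add: distrib_left)
  then obtain u where u: "real_vector u" "\<And>w. w \<in> K \<Longrightarrow> herm u w = 0" "s * Re (herm u u) > 0"
    using real orth by (cases "s * Re (herm x x) > 0") force+
  \<comment> \<open>As \<open>s\<close> is the sign of \<open>herm u u\<close>, the radicand is its
    absolute value.\<close>
  define c where "c = 1 / sqrt (s * Re (herm u u))"
  have c: "c * c * Re (herm u u) = s"
    using u(3) s by (auto simp: c_def field_simps)
  have "herm u u = of_real (Re (herm u u))"
    using cnj_herm[of u u] by (simp add: complex_eq_iff)
  then have "herm (of_real c *s u) (of_real c *s u) = of_real (c * c * Re (herm u u))"
    by (metis (no_types, lifting) complex_cnj_complex_of_real herm_simps(5,6) mult.assoc of_real_mult)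
  then have "herm (of_real c *s u) (of_real c *s u) = of_real s" by (simp only: c)
  then show thesis using u by (intro that[of "of_real c *s u"]) (auto simp: real_vector_simps herm_simps)
qed

text \<open>Gram-Schmidt among the real vectors: \<open>n\<close> of value -1, then \<open>p\<close>
  and \<open>m\<close> of value 1, pairwise orthogonal. The hyperbolic plane of \<open>p\<close> and
  \<open>n\<close> is then given an isotropic basis to match the antidiagonal Gram matrix.\<close>

lemma unitary_real_basis:
  obtains Q where "S ** Q = cnj_matrix Q" "transpose Q ** herm_form ** cnj_matrix Q = herm_form"
proof -
  obtain n where n: "real_vector n" "herm n n = -1"
  proof -
    \<comment> \<open>A sample vector of value -2.\<close>
    have "-1 * Re (herm (vector [1, 0, -1]) (vector [1, 0, -1])) > 0"
      by (simp add: herm_def)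
    from real_vector_of_sign[OF _ this, of "{}"] that show thesis by auto
  qed
  obtain p where p: "real_vector p" "herm p n = 0" "herm p p = 1"
  proof -
    define e :: "complex ^ 3" where "e = vector [1, 0, 1]"
    \<comment> \<open>Projection of \<open>e\<close> off \<open>n\<close>; the plus sign comes from
      \<open>herm n n = -1\<close>. Since \<open>herm e e = 2\<close>, the value stays
      positive.\<close>
    define z where "z = e + herm e n *s n"
    have "herm z z = herm e e + herm e n * herm n e"
      by (simp add: z_def herm_simps n cnj_herm algebra_simps)
    also have "\<dots> = 2 + of_real ((cmod (herm e n))\<^sup>2)"
      unfolding complex_norm_square cnj_herm by (simp add: e_def herm_def)
    finally have "1 * Re (herm z z) > 0"
      by (simp add: add_pos_nonneg del: of_real_power)
    moreover have "herm z n = 0" by (simp add: z_def herm_simps n)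
    ultimately obtain x where "real_vector x" "\<And>w. w \<in> {n} \<Longrightarrow> herm x w = 0" "herm x x = of_real 1"
      using n(1) by (elim real_vector_of_sign[of 1 z "{n}", rotated]) auto
    then show thesis using that[of x] by simp
  qed
  have np: "herm n p = 0" using p(2) cnj_herm[of p n] by simp
  obtain m where m: "real_vector m" "herm m n = 0" "herm m p = 0" "herm m m = 1"
  proof -
    \<comment> \<open>the conjugate cross product of \<open>p\<close> and \<open>n\<close>, transported by the form\<close>
    define z :: "complex ^ 3" where "z = vector [cnj (p$1 * n$2 - p$2 * n$1),
      cnj (p$3 * n$1 - p$1 * n$3), cnj (p$2 * n$3 - p$3 * n$2)]"
    \<comment> \<open>Lagrange's identity, with reversed sign since the form has determinant -1;
      here the value is 1.\<close>
    have "herm z z = herm p n * herm n p - herm p p * herm n n"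
      by (simp add: z_def herm_def algebra_simps)
    then have "1 * Re (herm z z) > 0" by (simp add: p n)
    moreover have "herm z n = 0" "herm z p = 0"
      by (simp_all add: z_def herm_def algebra_simps)
    ultimately obtain x where "real_vector x" "\<And>w. w \<in> {n, p} \<Longrightarrow> herm x w = 0" "herm x x = of_real 1"
      using n(1) p(1) by (elim real_vector_of_sign[of 1 z "{n, p}", rotated]) auto
    then show thesis using that[of x] by simp
  qed
  have nm: "herm n m = 0" "herm p m = 0" using m(2,3) cnj_herm[of m n] cnj_herm[of m p] by simp_all
  define r where "r = complex_of_real (1 / sqrt 2)"
  have r: "cnj r = r" "r * r = 1/2" by (auto simp: r_def simp flip: of_real_mult)
  \<comment> \<open>The vectors \<open>p + n\<close> and \<open>p - n\<close> are isotropic with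
    product 2, which the factor \<open>r\<close> normalizes to 1.\<close>
  define b :: "complex ^ 3 ^ 3" where "b = vector [r *s (p + n), m, r *s (p - n)]"
  have b: "b $ 1 = r *s (p + n)" "b $ 2 = m" "b $ 3 = r *s (p - n)" by (simp_all add: b_def)
  define Q where "Q = transpose b"
  have col: "column i Q = b $ i" for i by (simp add: Q_def column_def transpose_def vec_eq_iff)
  have "real_vector (r *s x)" if "real_vector x" for x
    unfolding r_def using that by (rule real_vector_simps)
  then have real: "real_vector (b $ i)" for i
    using exhaust_3[of i] n(1) p(1) m(1) by (elim disjE) (simp_all only: b real_vector_simps)
  show thesis
  proof (rule that[of Q])
    have "column i (S ** Q) = column i (cnj_matrix Q)" for i
    proof -
      have "column i (S ** Q) = S *v column i Q"
        by (simp add: matrix_vector_mul_assoc flip: matrix_mult_axis)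
      also have "\<dots> = cnj_vec (column i Q)" using real[of i] by (simp add: col real_vector_def)
      also have "\<dots> = column i (cnj_matrix Q)" by (simp add: vec_eq_iff column_def cnj_vec_def cnj_matrix_def)
      finally show ?thesis .
    qed
    then show "S ** Q = cnj_matrix Q" by (simp add: vec_eq_iff column_def)
    have "herm (b $ i) (b $ j) = herm_form $ i $ j" for i j
      using exhaust_3[of i] exhaust_3[of j]
      by (elim disjE)
        (simp_all add: b herm_simps n p m nm np r axis_component herm_form_component flip: mult.assoc)
    then show "transpose Q ** herm_form ** cnj_matrix Q = herm_form"
      by (simp add: vec_eq_iff gram_matrix col)
  qed
qed

end

section \<open>Determinant correction and conjugation into SO(2,1)\<close>

text \<open>Scaling a 3 by 3 matrix by \<open>u\<close> multiplies its determinant by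
  \<open>u ^ 3\<close>, while \<open>cnj u * u = 1\<close> keeps the Hermitian form.\<close>

lemma complex_cube_root_inverse:
  assumes "cmod d = 1"
  obtains u where "cnj u * u = 1" "u ^ 3 * d = 1"
proof -
  have d: "d \<noteq> 0" using assms by auto
  define u where "u = exp (- Ln d / 3)"
  have "u ^ 3 = exp (- Ln d)" by (simp add: u_def flip: exp_of_nat_mult)
  then have u: "u ^ 3 * d = 1" using d by (simp add: exp_minus)
  have "cmod u ^ 3 = 1" using arg_cong[OF u, of cmod] assms by (simp add: norm_mult norm_power)
  then have "cmod u = 1" using power_eq_imp_eq_base[of "cmod u" 3 1] by simp
  then have "cnj u * u = 1" by (metis complex_norm_square mult.commute of_real_1 power_one)
  then show thesis using that u by blast
qed

text \<open>Conjugation by \<open>g\<close> is an endomorphism of \<open>G\<close>, and images of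
  subgroups are subgroups.\<close>

lemma subgroup_conjugate:
  assumes "group G" "subgroup H G" "g \<in> carrier G"
  shows "subgroup (g <#\<^bsub>G\<^esub> H #>\<^bsub>G\<^esub> inv\<^bsub>G\<^esub> g) G"
proof -
  interpret group G by fact
  interpret H: subgroup H G by fact
  let ?c = "\<lambda>x. g \<otimes>\<^bsub>G\<^esub> x \<otimes>\<^bsub>G\<^esub> inv\<^bsub>G\<^esub> g"
  have "group_hom G G ?c"
  proof (unfold_locales, rule homI)
    fix x y assume xy: "x \<in> carrier G" "y \<in> carrier G"
    have "inv\<^bsub>G\<^esub> g \<otimes>\<^bsub>G\<^esub> (g \<otimes>\<^bsub>G\<^esub> z) = z" if "z \<in> carrier G" for z
      using assms(3) that by (simp flip: m_assoc)
    then show "?c (x \<otimes>\<^bsub>G\<^esub> y) = ?c x \<otimes>\<^bsub>G\<^esub> ?c y"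
      using xy assms(3) by (simp add: m_assoc)
  qed (use assms(3) in simp)
  then have "subgroup (?c ` H) G"
    by (rule group_hom.subgroup_img_is_subgroup) (rule assms(2))
  also have "?c ` H = g <#\<^bsub>G\<^esub> H #>\<^bsub>G\<^esub> inv\<^bsub>G\<^esub> g"
    by (auto simp: l_coset_def r_coset_def)
  finally show ?thesis .
qed

lemma acts_irreducibly_iff_not_reducible: "acts_irreducibly \<Gamma> \<longleftrightarrow> \<not> reducible \<Gamma>"
  unfolding acts_irreducibly_def reducible_def by blast

lemma cnj_matrix_eq_iff: "cnj_matrix A = A \<longleftrightarrow> (\<forall>i j. A $ i $ j \<in> \<real>)"
  by (simp add: vec_eq_iff cnj_matrix_def Reals_cnj_iff)

theorem theoremB:
  fixes \<Gamma> :: "(complex ^ 3 ^ 3) set"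
  assumes "subgroup \<Gamma> SU21"
    and "\<not> reducible \<Gamma>"
    and "trace_field \<Gamma> \<subseteq> \<real>"
  shows "\<exists>g\<in>carrier SU21. subgroup (g <#\<^bsub>SU21\<^esub> \<Gamma> #>\<^bsub>SU21\<^esub> inv\<^bsub>SU21\<^esub> g) SO21"
proof -
  interpret \<Gamma>: subgroup \<Gamma> SU21 by fact
  interpret SU21: group SU21 by (rule group_SU21)
  have irr: "acts_irreducibly \<Gamma>" using assms(2) by (simp add: acts_irreducibly_iff_not_reducible)
  have tr: "trace (cnj_matrix A) = trace A" if "A \<in> \<Gamma>" for A
  proof -
    have "trace A \<in> trace_field \<Gamma>"
      unfolding trace_field_def using that by (intro generate_field.incl imageI)
    then show ?thesis using assms(3) by (simp add: trace_cnj_matrix subset_iff Reals_cnj_iff)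
  qed
  have form: "transpose A ** herm_form ** cnj_matrix A = herm_form" if "A \<in> \<Gamma>" for A
    using \<Gamma>.mem_carrier[OF that] by (simp add: SU21_simps herm_preserving_iff)
  obtain S\<^sub>0 where S0: "invertible S\<^sub>0" "\<And>A. A \<in> \<Gamma> \<Longrightarrow> S\<^sub>0 ** A = cnj_matrix A ** S\<^sub>0"
  proof (rule irreducible_equal_traces_equivalent[OF _ _ _ irr acts_irreducibly_cnj[OF irr] tr])
    show "A ** B \<in> \<Gamma> \<and> cnj_matrix (A ** B) = cnj_matrix A ** cnj_matrix B" if "A \<in> \<Gamma>" "B \<in> \<Gamma>" for A B
      using \<Gamma>.m_closed[OF that] by (simp add: SU21_simps)
    show "mat 1 \<in> \<Gamma>" using \<Gamma>.one_closed by (simp add: SU21_simps)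
  qed auto
  obtain S where S: "invertible S" "\<And>A. A \<in> \<Gamma> \<Longrightarrow> S ** A = cnj_matrix A ** S" "cnj_matrix S ** S = mat 1"
    by (rule irreducible_conj_intertwiner[OF irr _ S0]) auto
  have "transpose (herm_form ** S) = herm_form ** S"
  proof (rule irreducible_invariant_bilinear_symmetric[OF irr])
    show "det (herm_form ** S) \<noteq> 0"
      using S(1) by (simp add: det_mul det_herm_form invertible_det_nz)
    \<comment> \<open>Moving \<open>A\<close> to the left of \<open>S\<close> conjugates it, and
      invariance of the Hermitian form applies.\<close>
    show "transpose A ** (herm_form ** S) ** A = herm_form ** S" if "A \<in> \<Gamma>" for A
      using form[OF that] S(2)[OF that] by (metis matrix_mul_assoc)
  qed simp
  then interpret real_structure S using S(3) by unfold_locales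
  obtain Q where Q: "S ** Q = cnj_matrix Q" "transpose Q ** herm_form ** cnj_matrix Q = herm_form"
    by (rule unitary_real_basis)
  \<comment> \<open>The determinants -1 of the Gram matrix cancel on both sides.\<close>
  have "det Q * cnj (det Q) = 1"
    using arg_cong[OF Q(2), of det] by (simp add: det_mul det_herm_form det_cnj_matrix)
  then have "cmod (det Q) = 1"
    by (metis complex_mod_sqrt_Re_mult_cnj one_complex.simps(1) real_sqrt_one)
  then obtain u where u: "cnj u * u = 1" "u ^ 3 * det Q = 1" by (rule complex_cube_root_inverse)
  define h where "h = mat u ** Q"
  have h: "h \<in> carrier SU21"
  proof -
    have "herm (h *v z) (h *v w) = herm (Q *v z) (Q *v w)" for z w
      using u(1) by (simp add: h_def mat_mult_vector herm_simps mult.commute mult.left_commute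
          flip: matrix_vector_mul_assoc mult.assoc)
    then show ?thesis
      using Q(2) u(2) by (simp add: SU21_simps h_def det_mul det_mat herm_preserving_iff[symmetric])
  qed
  \<comment> \<open>The columns of \<open>h\<close> are the new basis, so \<open>g ** A ** h\<close>
    is \<open>A\<close> written in that basis.\<close>
  define g where "g = inv\<^bsub>SU21\<^esub> h"
  have g: "g \<in> carrier SU21" "inv\<^bsub>SU21\<^esub> g = h" using h by (simp_all add: g_def)
  obtain B where B: "B ** cnj_matrix Q = mat 1"
    using u(2) invertible_det_nz[of "cnj_matrix Q"] by (auto simp: det_cnj_matrix invertible_def)
  \<comment> \<open>Both \<open>cnj_matrix Q ** cnj_matrix M\<close> and
    \<open>cnj_matrix Q ** M\<close> equal \<open>S ** A ** Q\<close>, and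
    \<open>cnj_matrix Q\<close> cancels.\<close>
  have conj_Q: "cnj_matrix M = M" if "A \<in> \<Gamma>" "Q ** M = A ** Q" for A M
  proof -
    have "cnj_matrix Q ** cnj_matrix M = cnj_matrix A ** cnj_matrix Q"
      using arg_cong[OF that(2), of cnj_matrix] by simp
    also have "\<dots> = S ** (A ** Q)"
      using S(2)[OF that(1)] by (simp add: matrix_mul_assoc flip: Q(1))
    also have "\<dots> = cnj_matrix Q ** M"
      by (simp add: matrix_mul_assoc Q(1) flip: that(2))
    finally have "B ** (cnj_matrix Q ** cnj_matrix M) = B ** (cnj_matrix Q ** M)" by simp
    then show ?thesis by (simp add: matrix_mul_assoc B)
  qed
  have "g ** A ** h \<in> carrier SO21" if A: "A \<in> \<Gamma>" for A
  proof -
    let ?M = "g ** A ** h"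
    have M: "?M \<in> carrier SU21"
      using SU21.m_closed[OF SU21.m_closed[OF g(1) \<Gamma>.mem_carrier[OF A]] h] by (simp add: SU21_simps)
    have "h ** g = mat 1" using SU21.r_inv[OF h] by (simp add: g_def SU21_simps)
    then have "h ** ?M = A ** h" by (simp add: matrix_mul_assoc)
    \<comment> \<open>Multiplying by \<open>cnj u\<close> strips the unit scalar from
      \<open>h\<close> and leaves the relation for \<open>Q\<close>.\<close>
    then have "mat (cnj u) ** (h ** ?M) = mat (cnj u) ** (A ** h)" by simp
    then have "Q ** ?M = A ** Q"
      using u(1) by (simp add: h_def matrix_mul_assoc mat_mult_mat mat_mult_commute[of A]
          mult.commute)
    with A have "cnj_matrix ?M = ?M" by (rule conj_Q)
    then show ?thesis using M by (simp only: SO21_def cnj_matrix_eq_iff) simp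
  qed
  then have "g <#\<^bsub>SU21\<^esub> \<Gamma> #>\<^bsub>SU21\<^esub> inv\<^bsub>SU21\<^esub> g \<subseteq> carrier SO21"
    unfolding g(2) by (auto simp: l_coset_def r_coset_def SU21_simps)
  then have "subgroup (g <#\<^bsub>SU21\<^esub> \<Gamma> #>\<^bsub>SU21\<^esub> inv\<^bsub>SU21\<^esub> g) (SU21\<lparr>carrier := carrier SO21\<rparr>)"
    by (intro SU21.subgroup_incl subgroup_conjugate subgroup_SO21 group_SU21 assms(1) g(1))
  also have "SU21\<lparr>carrier := carrier SO21\<rparr> = SO21" by (simp add: SO21_def)
  finally show ?thesis using g(1) by blast
qed

end
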